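(* Let $A$ and $B$ be finite non-empty subsets of $\mathbb{Z}$ with $|A| \ge |B|$. Then there exist elements $b_1,b_2,b_3 \in B$ such that $$|A+\{b_1,b_2,b_3\}| \ge |A|+|B|-1.$$
   Context: For subsets $X,Y$ of an abelian group, $X+Y=\{x+y : x\in X, y\in Y\}$. The elements $b_1,b_2,b_3$ are not required to be distinct. *)

theory Defs
  imports Complex_Main "HOL-Library.Set_Algebras"
begin

end

theory Submission
  imports Defs
begin

text \<open>
  Take \<open>p = Min B\<close>, \<open>q = Max B\<close> and \<open>m = q - p\<close>. If \<open>A\<close> meets \<open>k\<close> residue classes modulo \<open>m\<close>,
  then \<open>A + {p, q}\<close> has at least \<open>card A + k\<close> elements, since every class gains one. The set
  \<open>B - {q}\<close> is injective modulo \<open>m\<close>, so for each \<open>a \<in> A\<close> at most \<open>k\<close> of its elements \<open>b\<close> send \<open>a\<close>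
  to a class of \<open>A + {p, q}\<close>. By averaging, some \<open>b\<close> sends at least \<open>card B - 1 - k\<close> elements of
  \<open>A\<close> to new classes.
\<close>

lemma set_plus_pair: "A + {p, q} = (\<lambda>a. a + p) ` A \<union> (\<lambda>a. a + q) ` A"
  by (auto simp: set_plus_def)

lemma set_plus_triple: "A + {p, b, q} = (A + {p, q}) \<union> (\<lambda>a. a + b) ` A"
  by (auto simp: set_plus_def)

text \<open>In each class \<open>r\<close> modulo \<open>q - p\<close>, the largest element
  \<open>M r\<close> of \<open>A\<close> yields a sum \<open>M r + q\<close> outside the translate
  of \<open>A\<close> by \<open>p\<close>: otherwise \<open>M r + (q - p)\<close> would be a larger
  element of \<open>A\<close> in the same class.\<close>

lemma card_plus_pair_ge:
  fixes A :: "int set" and p q :: int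
  assumes "finite A" and "p < q"
  shows "card A + card ((\<lambda>a. a mod (q - p)) ` A) \<le> card (A + {p, q})"
proof -
  define m where "m = q - p"
  define R where "R = (\<lambda>a. a mod m) ` A"
  define M where "M r = Max {a \<in> A. a mod m = r}" for r
  have M: "M r \<in> A" "M r mod m = r" "a \<in> A \<Longrightarrow> a mod m = r \<Longrightarrow> a \<le> M r" if "r \<in> R" for r a
  proof -
    have ne: "{a \<in> A. a mod m = r} \<noteq> {}" and fin: "finite {a \<in> A. a mod m = r}"
      using that assms by (auto simp: R_def)
    show "M r \<in> A" "M r mod m = r" using Max_in[OF fin ne] by (auto simp: M_def)
    show "a \<in> A \<Longrightarrow> a mod m = r \<Longrightarrow> a \<le> M r" using fin by (auto simp: M_def)
  qed
  have notin: "M r + m \<notin> A" if "r \<in> R" for r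
    using M(2)[OF that] M(3)[OF that, of "M r + m"] assms(2) by (auto simp: m_def)
  have inj: "inj_on (\<lambda>r. M r + q) R"
    by (rule inj_onI) (metis M(2) add_right_cancel)
  have disj: "(\<lambda>a. a + p) ` A \<inter> (\<lambda>r. M r + q) ` R = {}"
  proof -
    have False if "a \<in> A" "r \<in> R" "a + p = M r + q" for a r
    proof -
      have "a = M r + m" using that(3) by (simp add: m_def)
      then show False using notin[OF that(2)] that(1) by simp
    qed
    then show ?thesis by blast
  qed
  have "finite R" using assms by (simp add: R_def)
  have "card A + card R = card ((\<lambda>a. a + p) ` A) + card ((\<lambda>r. M r + q) ` R)"
    using inj by (simp add: card_image inj_on_def)
  also have "\<dots> = card ((\<lambda>a. a + p) ` A \<union> (\<lambda>r. M r + q) ` R)"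
    using disj assms(1) \<open>finite R\<close> by (simp add: card_Un_disjoint)
  also have "\<dots> \<le> card (A + {p, q})"
    using M(1) assms(1) by (intro card_mono) (auto simp: set_plus_pair)
  finally show ?thesis by (simp add: R_def m_def)
qed

text \<open>Double counting of the pairs \<open>(a, b)\<close> with \<open>(a + b - p) mod m\<close>
  in \<open>R\<close>: if every \<open>b\<close> left too few elements of \<open>A\<close> outside
  \<open>R\<close>, there would be more such pairs than \<open>card R\<close> per element of
  \<open>A\<close>.\<close>

lemma exists_translate_avoiding:
  fixes A C R :: "int set" and m p :: int
  assumes "finite A" "finite C" "finite R" "C \<noteq> {}"
    and "card C \<le> card A" and inj: "inj_on (\<lambda>b. b mod m) C"
  shows "\<exists>b\<in>C. card C \<le> card R + card {a \<in> A. (a + b - p) mod m \<notin> R}"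
proof (rule ccontr)
  assume "\<not> ?thesis"
  then have neg: "card R + card {a \<in> A. (a + b - p) mod m \<notin> R} < card C" if "b \<in> C" for b
    using that by force
  then have lt: "card R < card C" using \<open>C \<noteq> {}\<close> by fastforce
  define d where "d = card C - card R"
  \<comment> \<open>The negated claim leaves fewer than \<open>d\<close> elements of
    \<open>A\<close> avoiding \<open>R\<close>; this strictness is the \<open>+ 1\<close>.\<close>
  have hit: "card A + 1 - d \<le> card {a \<in> A. (a + b - p) mod m \<in> R}" if "b \<in> C" for b
  proof -
    have "A = {a \<in> A. (a + b - p) mod m \<in> R} \<union> {a \<in> A. (a + b - p) mod m \<notin> R}" by auto
    then have "card A \<le> card {a \<in> A. (a + b - p) mod m \<in> R} + card {a \<in> A. (a + b - p) mod m \<notin> R}"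
      by (metis (no_types, lifting) card_Un_le)
    then show ?thesis using neg[OF that] by (simp add: d_def)
  qed
  \<comment> \<open>For fixed \<open>a\<close>, elements of \<open>C\<close> sent to the same class
    are congruent modulo \<open>m\<close>, hence equal.\<close>
  have few: "card {b \<in> C. (a + b - p) mod m \<in> R} \<le> card R" for a
  proof (rule card_inj_on_le[where f = "\<lambda>b. (a + b - p) mod m"])
    show "inj_on (\<lambda>b. (a + b - p) mod m) {b \<in> C. (a + b - p) mod m \<in> R}"
    proof (rule inj_onI)
      fix x y
      assume "x \<in> {b \<in> C. (a + b - p) mod m \<in> R}" "y \<in> {b \<in> C. (a + b - p) mod m \<in> R}"
        and "(a + x - p) mod m = (a + y - p) mod m"
      then show "x = y" using inj by (auto simp: inj_on_def mod_eq_dvd_iff)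
    qed
  qed (use assms in auto)
  have "card C * (card A + 1 - d) \<le> (\<Sum>b\<in>C. card {a \<in> A. (a + b - p) mod m \<in> R})"
    using sum_bounded_below[of C "card A + 1 - d"] hit by simp
  also have "\<dots> = (\<Sum>a\<in>A. card {b \<in> C. (a + b - p) mod m \<in> R})"
    using assms(1,2) by (rule sum_multicount_gen[symmetric]) simp_all
  also have "\<dots> \<le> card A * card R"
    using sum_bounded_above[of A _ "card R"] few by simp
  finally have "int (card C) * int (card A + 1 - d) \<le> int (card A) * int (card R)"
    by (simp flip: of_nat_mult)
  \<comment> \<open>The subtraction does not truncate, as \<open>d\<close> is at most
    \<open>card C\<close> and so at most \<open>card A\<close>.\<close>
  moreover have "int (card A + 1 - d) = int (card A) + 1 - int d"
    using assms(5) by (simp add: d_def)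
  moreover have "int (card R) = int (card C) - int d" using lt by (simp add: d_def)
  \<comment> \<open>The products of \<open>card A\<close> and \<open>card C\<close> cancel. The
    surplus \<open>card C\<close> comes from the \<open>+ 1\<close>; as \<open>card C\<close> is at
    most \<open>card A\<close>, it would have to vanish.\<close>
  ultimately have "int (card A) * int d + int (card C) \<le> int (card C) * int d"
    by (simp add: algebra_simps)
  moreover have "int (card C) * int d \<le> int (card A) * int d"
    using assms(5) by (simp add: mult_right_mono)
  ultimately show False using lt by linarith
qed

theorem theorem1:
  fixes A B :: "int set"
  assumes "finite A" and "finite B"
    and "A \<noteq> {}" and "B \<noteq> {}"
    and "card A \<ge> card B"
  shows "\<exists>b1\<in>B. \<exists>b2\<in>B. \<exists>b3\<in>B. card (A + {b1, b2, b3}) \<ge> card A + card B - 1"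
proof -
  define p where "p = Min B"
  define q where "q = Max B"
  have pB: "p \<in> B" and qB: "q \<in> B" and bounds: "\<And>b. b \<in> B \<Longrightarrow> p \<le> b \<and> b \<le> q"
    using assms by (auto simp: p_def q_def)
  show ?thesis
  proof (cases "p = q")
    case True
    then have "B = {p}" using bounds pB by force
    moreover have "A + {p} = (\<lambda>a. a + p) ` A" by (auto simp: set_plus_def)
    ultimately show ?thesis by (simp add: card_image inj_on_def)
  next
    case False
    then have "p < q" using bounds[OF pB] by simp
    define m where "m = q - p"
    define R where "R = (\<lambda>a. a mod m) ` A"
    \<comment> \<open>\<open>q\<close> is congruent to \<open>p\<close> modulo \<open>m\<close>.
      Without it, all elements lie in the interval from \<open>p\<close> to \<open>q - 1\<close>, of
      length \<open>m\<close>; its loss is the \<open>- 1\<close> in the bound.\<close>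
    define C where "C = B - {q}"
    have cardC: "card C = card B - 1" using qB assms(2) by (simp add: C_def)
    have inj: "inj_on (\<lambda>b. b mod m) C"
    proof (rule inj_onI)
      fix x y assume xy: "x \<in> C" "y \<in> C" "x mod m = y mod m"
      have "(x - p) mod m = (y - p) mod m" using xy(3) by (metis mod_diff_left_eq)
      moreover have "0 \<le> x - p" "x - p < m" "0 \<le> y - p" "y - p < m"
        using xy(1,2) bounds[of x] bounds[of y] by (auto simp: C_def m_def)
      ultimately show "x = y" by simp
    qed
    have "\<exists>b\<in>C. card C \<le> card R + card {a \<in> A. (a + b - p) mod m \<notin> R}"
      using assms cardC pB False inj
      by (intro exists_translate_avoiding) (auto simp: C_def R_def)
    then obtain b where b: "b \<in> C" "card C \<le> card R + card {a \<in> A. (a + b - p) mod m \<notin> R}"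
      by blast
    define N where "N = {a \<in> A. (a + b - p) mod m \<notin> R}"
    \<comment> \<open>Since \<open>p\<close> and \<open>q\<close> agree modulo \<open>m\<close>,
      both translates, shifted back by \<open>p\<close>, fall into the classes of
      \<open>A\<close>.\<close>
    have old: "(x - p) mod m \<in> R" if x: "x \<in> A + {p, q}" for x
    proof -
      consider a where "a \<in> A" "x = a + p" | a where "a \<in> A" "x = a + q"
        using x by (auto simp: set_plus_pair)
      then show ?thesis
      proof cases
        case 1
        then show ?thesis by (simp add: R_def)
      next
        case 2
        then have "x - p = a + m" by (simp add: m_def)
        then have "(x - p) mod m = a mod m" by simp
        then show ?thesis using 2(1) by (simp add: R_def)
      qed
    qed
    have disj: "(A + {p, q}) \<inter> (\<lambda>a. a + b) ` N = {}"
      using old by (auto simp: N_def)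
    have fin: "finite (A + {p, q})" "finite N" using assms(1) by (auto simp: set_plus_pair N_def)
    \<comment> \<open>The \<open>card R\<close> lost in choosing \<open>b\<close> is what the pair
      \<open>p\<close>, \<open>q\<close> gains.\<close>
    have "card A + card B - 1 \<le> card A + card R + card N"
      using b(2) cardC by (simp add: N_def)
    also have "\<dots> \<le> card (A + {p, q}) + card ((\<lambda>a. a + b) ` N)"
      using card_plus_pair_ge[OF assms(1) \<open>p < q\<close>]
      by (simp add: R_def m_def card_image inj_on_def)
    also have "\<dots> = card ((A + {p, q}) \<union> (\<lambda>a. a + b) ` N)"
      using disj fin by (simp add: card_Un_disjoint)
    also have "\<dots> \<le> card (A + {p, b, q})"
      using assms(1) fin unfolding set_plus_triple by (intro card_mono) (auto simp: N_def)
    finally show ?thesis using pB qB b(1) by (auto simp: C_def)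
  qed
qed

end
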